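(* Let $\langle X,d\rangle$ be a metric space. Then the following conditions are equivalent: (1) $X$ is a uniformly star superparacompact space; (2) each cofinally Bourbaki quasi-Cauchy sequence in $X$ has a cluster point in $X$; (3) for each locally finite open cover of $X$, there exists $\mu>0$ such that for each $x\in X$, $S^\infty_d(x,\mu)$ intersects at most finitely many members of the cover; (4) for each open cover $\mathcal V$ of $X$, there exists $\mu>0$ such that for each $x\in X$, $S^\infty_d(x,\mu)$ is covered by finitely many members of $\mathcal V$; (5) for each open cover $\mathcal V$ of $X$ directed by inclusion, there exists $\mu>0$ such that $\{S^\infty_d(x,\mu):x\in X\}$ refines $\mathcal V$; (6) for every metric space $\langle Y,\rho\rangle$, every continuous $f:\langle X,d\rangle\to\langle Y,\rho\rangle$ is uniformly locally component bounded on $X$; (7) every $f\in C(X,\mathbb R)$ is uniformly locally component bounded on $X$; (8) $\operatorname{nslc}(X)$ is compact, and for every $\delta>0$ there exists $\mu>0$ such that $x\in X\setminus S_d(\operatorname{nslc}(X),\delta)$ implies $f_c(x)>\mu$; (9) each sequence $\langle x_n\rangle$ in $X$ with $\lim_{n\to\infty}f_c(x_n)=0$ has a cluster point in $X$; (10) whenever $\rho$ is a metric on $X$ equivalent to $d$, there exists $\delta>0$ such that for all $x\in X$, $S^\infty_d(x,\delta)$ is $\rho$-bounded; (11) whenever $\langle A_n\rangle$ is a decreasing sequence of nonempty closed subsets of $X$ with $\lim_{n\to\infty}\inf\{f_c(x):x\in A_n\}=0$, then $\bigcap_{n=1}^\infty A_n\neq\emptyset$; (12) whenever $\langle A_n\rangle$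 is a decreasing sequence of nonempty closed subsets of $X$ with $\lim_{n\to\infty}\sup\{f_c(x):x\in A_n\}=0$, then $\bigcap_{n=1}^\infty A_n\neq\emptyset$.
   Context: Metric spaces are assumed to contain at least two points. For $x\in X$ and $\varepsilon>0$, $S^\infty_d(x,\varepsilon)$ is the set of all $y\in X$ for which there is a finite sequence $x=x_0,x_1,\dots,x_n=y$ in $X$ with $d(x_{i-1},x_i)<\varepsilon$ for $i=1,\dots,n$. For $B\subseteq X$, $S_d(B,\delta)=\bigcup_{b\in B}\{y\in X:d(y,b)<\delta\}$. Define $f_c(x)=\sup\{\varepsilon>0: S^\infty_d(x,\varepsilon)\text{ is compact}\}\in[0,\infty]$ if $S^\infty_d(x,\varepsilon)$ is compact for some $\varepsilon>0$, and $f_c(x)=0$ otherwise; $\operatorname{nslc}(X)=\{x\in X:f_c(x)=0\}$. $X$ is a uniformly star superparacompact space if for each open cover $\mathcal V$ of $X$ there exist $\mu>0$ and an open cover $\mathcal U$ of $X$ refining $\mathcal V$ such that for each $x\in X$, $S^\infty_d(x,\mu)$ intersects at most finitely many members of $\mathcal U$. A family $\mathcal U$ refines $\mathcal V$ if each member of $\mathcal U$ is contained in some member of $\mathcal V$. A cover is directed by inclusion if the union of any two of its members is contained in some member. A sequence $\langle x_n\rangle$ is cofinally Bourbaki quasi-Cauchy if for every $\varepsilon>0$ there exist an infinite $N_\varepsilon\subseteq\mathbb N$ and $p\in X$ with $x_n\in S^\infty_d(p,\varepsilon)$ for every $n\in N_\varepsilon$. A function $f:\langle X,d\rangle\to\langle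 Y,\rho\rangle$ is uniformly locally component bounded on $A\subseteq X$ if there exists $\delta>0$ such that for all $a\in A$, $f(S^\infty_d(a,\delta))$ is a metrically bounded subset of $Y$. $C(X,\mathbb R)$ is the set of continuous real-valued functions on $X$. Two metrics are equivalent if they induce the same topology. *)

theory Defs
  imports "HOL-Analysis.Analysis"
begin

abbreviation mtop :: "'a set \<Rightarrow> ('a \<Rightarrow> 'a \<Rightarrow> real) \<Rightarrow> 'a topology" where
  "mtop M d \<equiv> Metric_space.mtopology M d"

text \<open>The set $S^\infty_d(x,\varepsilon)$ of points reachable from $x$ by an $\varepsilon$-chain.\<close>

definition chain_ball :: "'a set \<Rightarrow> ('a \<Rightarrow> 'a \<Rightarrow> real) \<Rightarrow> 'a \<Rightarrow> real \<Rightarrow> 'a set" where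
  "chain_ball M d x \<epsilon> =
     {y. \<exists>(n::nat) p. p 0 = x \<and> p n = y \<and> (\<forall>i\<le>n. p i \<in> M) \<and> (\<forall>i<n. d (p i) (p (Suc i)) < \<epsilon>)}"

definition enlargement :: "'a set \<Rightarrow> ('a \<Rightarrow> 'a \<Rightarrow> real) \<Rightarrow> 'a set \<Rightarrow> real \<Rightarrow> 'a set" where
  "enlargement M d B \<delta> = (\<Union>b\<in>B. {y \<in> M. d y b < \<delta>})"

text \<open>The function $f_c$, with values in $[0,\infty]$. In \<^typ>\<open>ereal\<close> the supremum of the
  empty set is $-\infty$, so the second case is needed.\<close>

definition f_c :: "'a set \<Rightarrow> ('a \<Rightarrow> 'a \<Rightarrow> real) \<Rightarrow> 'a \<Rightarrow> ereal" where
  "f_c M d x =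
     (if \<exists>\<epsilon>>0. compactin (mtop M d) (chain_ball M d x \<epsilon>)
      then Sup {ereal \<epsilon> |\<epsilon>. \<epsilon> > 0 \<and> compactin (mtop M d) (chain_ball M d x \<epsilon>)}
      else 0)"

definition nslc :: "'a set \<Rightarrow> ('a \<Rightarrow> 'a \<Rightarrow> real) \<Rightarrow> 'a set" where
  "nslc M d = {x \<in> M. f_c M d x = 0}"

definition open_cover :: "'a topology \<Rightarrow> 'a set set \<Rightarrow> bool" where
  "open_cover X \<V> \<longleftrightarrow> (\<forall>V\<in>\<V>. openin X V) \<and> \<Union>\<V> = topspace X"

definition cover_refines :: "'a set set \<Rightarrow> 'a set set \<Rightarrow> bool" where
  "cover_refines \<U> \<V> \<longleftrightarrow> (\<forall>U\<in>\<U>. \<exists>V\<in>\<V>. U \<subseteq> V)"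

definition directed_by_inclusion :: "'a set set \<Rightarrow> bool" where
  "directed_by_inclusion \<V> \<longleftrightarrow> (\<forall>U\<in>\<V>. \<forall>V\<in>\<V>. \<exists>W\<in>\<V>. U \<union> V \<subseteq> W)"

definition meets_finitely_many :: "'a set \<Rightarrow> 'a set set \<Rightarrow> bool" where
  "meets_finitely_many S \<U> \<longleftrightarrow> finite {U \<in> \<U>. S \<inter> U \<noteq> {}}"

definition uniformly_star_superparacompact :: "'a set \<Rightarrow> ('a \<Rightarrow> 'a \<Rightarrow> real) \<Rightarrow> bool" where
  "uniformly_star_superparacompact M d \<longleftrightarrow>
     (\<forall>\<V>. open_cover (mtop M d) \<V> \<longrightarrow>
        (\<exists>\<mu>>0. \<exists>\<U>. open_cover (mtop M d) \<U> \<and> cover_refines \<U> \<V> \<and>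
           (\<forall>x\<in>M. meets_finitely_many (chain_ball M d x \<mu>) \<U>)))"

definition cofinally_Bourbaki_quasi_Cauchy ::
    "'a set \<Rightarrow> ('a \<Rightarrow> 'a \<Rightarrow> real) \<Rightarrow> (nat \<Rightarrow> 'a) \<Rightarrow> bool" where
  "cofinally_Bourbaki_quasi_Cauchy M d \<sigma> \<longleftrightarrow>
     range \<sigma> \<subseteq> M \<and>
     (\<forall>\<epsilon>>0. \<exists>N p. infinite N \<and> p \<in> M \<and> (\<forall>n\<in>N. \<sigma> n \<in> chain_ball M d p \<epsilon>))"

definition cluster_point :: "'a topology \<Rightarrow> (nat \<Rightarrow> 'a) \<Rightarrow> 'a \<Rightarrow> bool" where
  "cluster_point X \<sigma> x \<longleftrightarrow>
     x \<in> topspace X \<and> (\<forall>U. openin X U \<and> x \<in> U \<longrightarrow> infinite {n. \<sigma> n \<in> U})"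

definition unif_loc_component_bounded ::
    "'a set \<Rightarrow> ('a \<Rightarrow> 'a \<Rightarrow> real) \<Rightarrow> 'b set \<Rightarrow> ('b \<Rightarrow> 'b \<Rightarrow> real) \<Rightarrow> ('a \<Rightarrow> 'b) \<Rightarrow> 'a set \<Rightarrow> bool" where
  "unif_loc_component_bounded M d Y \<rho> f A \<longleftrightarrow>
     (\<exists>\<delta>>0. \<forall>a\<in>A. Metric_space.mbounded Y \<rho> (f ` chain_ball M d a \<delta>))"

text \<open>Every continuous map from $M$ into a metric space (with at least two points) whose carrier
  is a subset of the given type is uniformly locally component bounded on $M$. A quantifier over
  all metric spaces ranges over types as well, which a HOL formula cannot express. A theorem is
  implicitly universal in its type variables, so the type is made a parameter here.\<close>

definition continuous_maps_ulcb :: "'b itself \<Rightarrow> 'a set \<Rightarrow> ('a \<Rightarrow> 'a \<Rightarrow> real) \<Rightarrow> bool" where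
  "continuous_maps_ulcb (_ :: 'b itself) M d \<longleftrightarrow>
     (\<forall>(Y :: 'b set) \<rho> f.
        Metric_space Y \<rho> \<and> (\<exists>u\<in>Y. \<exists>v\<in>Y. u \<noteq> v) \<and> continuous_map (mtop M d) (mtop Y \<rho>) f
        \<longrightarrow> unif_loc_component_bounded M d Y \<rho> f M)"

definition all_equivalent :: "bool list \<Rightarrow> bool" where
  "all_equivalent Ps \<longleftrightarrow> (\<forall>P\<in>set Ps. \<forall>Q\<in>set Ps. P \<longleftrightarrow> Q)"

end

theory Submission
  imports Defs
begin

text \<open>
  Reachability by \<open>\<epsilon>\<close>-chains is an equivalence relation, so the sets \<open>chain_ball M d x \<epsilon>\<close> are the
  members of a partition of the space into open, hence clopen, components, and the partition
  becomes finer as \<open>\<epsilon>\<close> decreases. Two consequences are used throughout. A component at the scale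
  \<open>\<epsilon> > 0\<close> is compact as soon as \<open>\<epsilon> < f_c y\<close> for one of its points \<open>y\<close>. And
  \<open>f_c y \<le> max (f_c x) (d x y)\<close> (lemma \<open>f_c_le_max\<close>), so that cluster points of sequences along
  which \<open>f_c\<close> tends to zero lie in \<open>nslc\<close>.

  The twelve conditions, numbered as in the theorem, are joined in the cycle
  (4), (5), (6), (7), (2), (9), (8), (4).
  Finite subsets of a directed cover have upper bounds, which turns finite covers of components
  into refinements, and preimages of concentric balls form a directed cover, which bounds
  continuous functions on components. A sequence without cluster point carries a continuous real
  function that is at least \<open>n\<close> at its \<open>n\<close>-th term (lemma \<open>continuous_map_unbounded_on_sequence\<close>); if
  the sequence is cofinally Bourbaki quasi-Cauchy, then this function is unbounded on some component
  at every scale. The step from such sequences to sequences with \<open>f_c\<close> tending to zero (lemma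
  \<open>f_c_null_cluster_point\<close>) is the hardest: it replaces the terms by whole sequences inside
  noncompact components around them and interleaves these. Sequences with \<open>f_c\<close> tending to zero
  show that \<open>nslc\<close> is compact and that \<open>f_c\<close> is bounded away from zero outside its enlargements.
  Finally, given an open cover, finitely many members cover an enlargement of \<open>nslc\<close>, and every
  component at a small scale is contained in this enlargement or compact (lemma
  \<open>chain_balls_finitely_covered\<close>); in either case it is covered by finitely many members.

  The other conditions are attached by detours. For (1), a partition into components that are
  each covered by finitely many sets yields the required refinement of the cover directly. For (3)
  and (10), a continuous real function \<open>f\<close> is encoded in the locally finite cover by preimages of
  short intervals, or in the equivalent metric \<open>d x y + \<bar>f x - f y\<bar>\<close>. For (11) and (12), sequences
  are replaced by the closures of their tails.
\<close>

section \<open>Chain components\<close>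

text \<open>The points reachable by \<open>\<epsilon>\<close>-chains form the classes of the equivalence relation generated
  by this step relation, which gives access to the theory of reflexive transitive closures.\<close>

definition (in Metric_space) chain_rel :: "real \<Rightarrow> ('a \<times> 'a) set" where
  "chain_rel \<epsilon> = {(u, v). u \<in> M \<and> v \<in> M \<and> d u v < \<epsilon>}"

lemma (in Metric_space) in_chain_rel [simp]:
  "(u, v) \<in> chain_rel \<epsilon> \<longleftrightarrow> u \<in> M \<and> v \<in> M \<and> d u v < \<epsilon>"
  by (simp add: chain_rel_def)

lemma (in Metric_space) chain_ball_iff_rtrancl:
  "y \<in> chain_ball M d x \<epsilon> \<longleftrightarrow> x \<in> M \<and> (x, y) \<in> (chain_rel \<epsilon>)\<^sup>*"
proof
  assume "y \<in> chain_ball M d x \<epsilon>"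
  then obtain n p where p: "p 0 = x" "p n = y" "\<forall>i\<le>n. p i \<in> M" "\<forall>i<n. d (p i) (p (Suc i)) < \<epsilon>"
    unfolding chain_ball_def by blast
  then have "(x, y) \<in> chain_rel \<epsilon> ^^ n"
    by (auto simp: relpow_fun_conv intro!: exI[of _ p])
  then show "x \<in> M \<and> (x, y) \<in> (chain_rel \<epsilon>)\<^sup>*"
    using p(1) spec[OF p(3), of 0] by (intro conjI relpow_imp_rtrancl) simp_all
next
  assume "x \<in> M \<and> (x, y) \<in> (chain_rel \<epsilon>)\<^sup>*"
  then obtain n where x: "x \<in> M" and "(x, y) \<in> chain_rel \<epsilon> ^^ n"
    using rtrancl_imp_relpow by blast
  then obtain p where p: "p 0 = x" "p n = y"
      and step: "\<And>i. i < n \<Longrightarrow> (p i, p (Suc i)) \<in> chain_rel \<epsilon>"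
    unfolding relpow_fun_conv by blast
  have "p i \<in> M" if "i \<le> n" for i
  proof (cases i)
    case 0
    then show ?thesis
      using x p(1) by simp
  next
    case (Suc j)
    then show ?thesis
      using step[of j] that by simp
  qed
  then show "y \<in> chain_ball M d x \<epsilon>"
    unfolding chain_ball_def using p step by (intro CollectI exI[of _ n] exI[of _ p]) simp
qed

context Metric_space
begin

lemma chain_ball_subset: "chain_ball M d x \<epsilon> \<subseteq> M"
  unfolding chain_ball_def by force

lemma chain_ball_refl: "x \<in> M \<Longrightarrow> x \<in> chain_ball M d x \<epsilon>"
  by (simp add: chain_ball_iff_rtrancl)

lemma chain_ball_sym:
  assumes "y \<in> chain_ball M d x \<epsilon>"
  shows "x \<in> chain_ball M d y \<epsilon>"
proof -
  have "sym (chain_rel \<epsilon>)"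
    by (auto simp: sym_def commute)
  moreover have "(x, y) \<in> (chain_rel \<epsilon>)\<^sup>*"
    using assms by (simp add: chain_ball_iff_rtrancl)
  ultimately have "(y, x) \<in> (chain_rel \<epsilon>)\<^sup>*"
    by (rule symD[OF sym_rtrancl])
  then show ?thesis
    using assms chain_ball_subset chain_ball_iff_rtrancl by blast
qed

lemma chain_ball_trans:
  assumes "y \<in> chain_ball M d x \<epsilon>" and "z \<in> chain_ball M d y \<epsilon>"
  shows "z \<in> chain_ball M d x \<epsilon>"
  using assms rtrancl_trans[of x y _ z] by (simp add: chain_ball_iff_rtrancl)

lemma chain_ball_eq:
  assumes "y \<in> chain_ball M d x \<epsilon>"
  shows "chain_ball M d y \<epsilon> = chain_ball M d x \<epsilon>"
  using chain_ball_trans[OF assms] chain_ball_trans[OF chain_ball_sym[OF assms]] by blast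

lemma chain_ball_step: "x \<in> M \<Longrightarrow> y \<in> M \<Longrightarrow> d x y < \<epsilon> \<Longrightarrow> y \<in> chain_ball M d x \<epsilon>"
  by (auto simp: chain_ball_iff_rtrancl)

lemma chain_ball_mono:
  assumes "\<epsilon> \<le> \<delta>"
  shows "chain_ball M d x \<epsilon> \<subseteq> chain_ball M d x \<delta>"
proof -
  have "(chain_rel \<epsilon>)\<^sup>* \<subseteq> (chain_rel \<delta>)\<^sup>*"
    using assms by (intro rtrancl_mono) auto
  then show ?thesis
    by (auto simp: chain_ball_iff_rtrancl)
qed

lemma mball_subset_chain_ball: "y \<in> chain_ball M d x \<epsilon> \<Longrightarrow> mball y \<epsilon> \<subseteq> chain_ball M d x \<epsilon>"
  by (auto intro: chain_ball_trans[OF _ chain_ball_step])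

lemma openin_chain_ball:
  assumes "0 < \<epsilon>"
  shows "openin mtopology (chain_ball M d x \<epsilon>)"
  unfolding openin_mtopology
  using assms chain_ball_subset mball_subset_chain_ball by blast

text \<open>The complement is a union of other components, hence also open.\<close>

lemma closedin_chain_ball:
  assumes "0 < \<epsilon>"
  shows "closedin mtopology (chain_ball M d x \<epsilon>)"
proof -
  have "M - chain_ball M d x \<epsilon> = \<Union> ((\<lambda>y. chain_ball M d y \<epsilon>) ` (M - chain_ball M d x \<epsilon>))"
  proof (intro equalityI subsetI)
    fix z assume "z \<in> \<Union> ((\<lambda>y. chain_ball M d y \<epsilon>) ` (M - chain_ball M d x \<epsilon>))"
    then obtain y where y: "y \<notin> chain_ball M d x \<epsilon>" and z: "z \<in> chain_ball M d y \<epsilon>"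
      by blast
    have "z \<notin> chain_ball M d x \<epsilon>"
      using y chain_ball_eq[of z x \<epsilon>] chain_ball_sym[OF z] by auto
    then show "z \<in> M - chain_ball M d x \<epsilon>"
      using z chain_ball_subset by blast
  qed (use chain_ball_refl in blast)
  moreover have "openin mtopology (\<Union> ((\<lambda>y. chain_ball M d y \<epsilon>) ` (M - chain_ball M d x \<epsilon>)))"
    by (intro openin_Union) (use assms openin_chain_ball in auto)
  ultimately show ?thesis
    using chain_ball_subset by (simp add: closedin_def)
qed

section \<open>Cluster points\<close>

lemma cluster_point_metric:
  "cluster_point mtopology \<sigma> x \<longleftrightarrow> x \<in> M \<and> (\<forall>e>0. infinite {n. \<sigma> n \<in> mball x e})"
proof (intro iffI conjI allI impI; (elim conjE)?)
  assume x: "x \<in> M" and inf: "\<forall>e>0. infinite {n. \<sigma> n \<in> mball x e}"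
  have "infinite {n. \<sigma> n \<in> U}" if U: "openin mtopology U" "x \<in> U" for U
  proof -
    obtain e where "e > 0" "mball x e \<subseteq> U"
      using U by (auto simp: openin_mtopology)
    moreover from this have "{n. \<sigma> n \<in> mball x e} \<subseteq> {n. \<sigma> n \<in> U}"
      by blast
    ultimately show ?thesis
      using inf infinite_super by blast
  qed
  then show "cluster_point mtopology \<sigma> x"
    using x by (simp add: cluster_point_def)
qed (auto simp: cluster_point_def)

lemma cluster_point_compose:
  assumes "cluster_point X (\<sigma> \<circ> r) x" and "\<And>n. n \<le> r n"
  shows "cluster_point X \<sigma> x"
  unfolding cluster_point_def
proof (intro conjI allI impI)
  fix U assume "openin X U \<and> x \<in> U"
  then have inf: "infinite {n. (\<sigma> \<circ> r) n \<in> U}"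
    using assms(1) by (simp add: cluster_point_def)
  show "infinite {n. \<sigma> n \<in> U}"
    unfolding infinite_nat_iff_unbounded_le
  proof
    fix m
    obtain n where "n \<ge> m" "\<sigma> (r n) \<in> U"
      using inf unfolding infinite_nat_iff_unbounded_le by auto
    then show "\<exists>n\<ge>m. n \<in> {n. \<sigma> n \<in> U}"
      using assms(2)[of n] by (intro exI[of _ "r n"]) auto
  qed
qed (use assms(1) in \<open>simp add: cluster_point_def\<close>)

text \<open>An infinite subset of \<open>S\<close> contains an injective sequence. Every neighbourhood of a cluster
  point of it contains infinitely many of its values, so the cluster point is an accumulation
  point of the subset, and lies in \<open>S\<close> because \<open>S\<close> is closed.\<close>

lemma compactin_if_cluster_points:
  assumes "closedin mtopology S"
    and cl: "\<And>\<sigma>. range \<sigma> \<subseteq> S \<Longrightarrow> \<exists>x. cluster_point mtopology \<sigma> x"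
  shows "compactin mtopology S"
  unfolding compactin_eq_Bolzano_Weierstrass
proof (intro conjI allI impI)
  show "S \<subseteq> M"
    using assms(1) closedin_metric by blast
  fix T assume T: "T \<subseteq> S \<and> infinite T"
  then obtain \<sigma> :: "nat \<Rightarrow> 'a" where \<sigma>: "inj \<sigma>" "range \<sigma> \<subseteq> T"
    by (meson infinite_countable_subset)
  then obtain x where x: "x \<in> M" "\<And>e. e > 0 \<Longrightarrow> infinite {n. \<sigma> n \<in> mball x e}"
    using cl[of \<sigma>] T unfolding cluster_point_metric by (meson order_trans)
  have "x \<in> mtopology derived_set_of T"
    unfolding metric_derived_set_of
  proof (intro CollectI conjI allI impI)
    fix r :: real assume "r > 0"
    moreover have "finite {n. \<sigma> n = x}"
      using \<sigma>(1) by (simp add: finite_vimageI[of "{x}" \<sigma>, unfolded vimage_def, simplified])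
    ultimately have "infinite ({n. \<sigma> n \<in> mball x r} - {n. \<sigma> n = x})"
      using x(2) by (simp add: Diff_infinite_finite)
    then obtain n where "\<sigma> n \<in> mball x r" "\<sigma> n \<noteq> x"
      using infinite_imp_nonempty by blast
    then show "\<exists>y\<in>T. y \<noteq> x \<and> y \<in> mball x r"
      using \<sigma>(2) by blast
  qed (fact x)
  moreover have "mtopology derived_set_of T \<subseteq> S"
    by (meson T assms(1) closedin_contains_derived_set derived_set_of_mono order_trans)
  ultimately show "S \<inter> mtopology derived_set_of T \<noteq> {}"
    by blast
qed

section \<open>The modulus of compactness\<close>

lemma f_c_ge:
  assumes "0 < \<epsilon>" and "compactin mtopology (chain_ball M d x \<epsilon>)"
  shows "ereal \<epsilon> \<le> f_c M d x"
  unfolding f_c_def using assms by (auto intro!: Sup_upper)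

lemma f_c_nonneg: "0 \<le> f_c M d x"
proof (cases "\<exists>\<epsilon>>0. compactin mtopology (chain_ball M d x \<epsilon>)")
  case True
  then obtain \<epsilon> where "\<epsilon> > 0" "compactin mtopology (chain_ball M d x \<epsilon>)"
    by blast
  then have "0 \<le> ereal \<epsilon>" "ereal \<epsilon> \<le> f_c M d x"
    using f_c_ge by auto
  then show ?thesis
    by (rule order_trans)
qed (auto simp: f_c_def)

text \<open>Compactness passes from a component to the finer ones, which are closed subsets of it.\<close>

lemma compactin_if_less_f_c:
  assumes "0 < \<epsilon>" and "ereal \<epsilon> < f_c M d x"
  shows "compactin mtopology (chain_ball M d x \<epsilon>)"
proof -
  have "\<exists>\<epsilon>>0. compactin mtopology (chain_ball M d x \<epsilon>)"
    using assms by (auto simp: f_c_def split: if_splits)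
  then have "ereal \<epsilon> < Sup {ereal \<epsilon> |\<epsilon>. \<epsilon> > 0 \<and> compactin mtopology (chain_ball M d x \<epsilon>)}"
    using assms(2) by (simp add: f_c_def)
  then obtain \<delta> where "\<epsilon> < \<delta>" and \<delta>: "compactin mtopology (chain_ball M d x \<delta>)"
    by (auto simp: less_Sup_iff)
  then have "chain_ball M d x \<epsilon> \<subseteq> chain_ball M d x \<delta>"
    by (intro chain_ball_mono) simp
  then show ?thesis
    using \<delta> closedin_chain_ball[OF assms(1)] by (metis closed_compactin)
qed

text \<open>For every \<open>\<epsilon> > d x y\<close> the two points have the same \<open>\<epsilon>\<close>-component, so a compact
  component of \<open>y\<close> at such a scale is one of \<open>x\<close>.\<close>

lemma f_c_le_max:
  assumes "x \<in> M" "y \<in> M"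
  shows "f_c M d y \<le> max (f_c M d x) (ereal (d x y))"
proof (rule ccontr)
  assume "\<not> ?thesis"
  then have "max (f_c M d x) (ereal (d x y)) < f_c M d y"
    by (simp only: not_le)
  from ereal_dense2[OF this] obtain \<epsilon> where \<epsilon>: "max (f_c M d x) (ereal (d x y)) < ereal \<epsilon>" "ereal \<epsilon> < f_c M d y"
    by blast
  then have "d x y < \<epsilon>"
    by simp
  moreover from this have "0 < \<epsilon>"
    using nonneg[of x y] by linarith
  ultimately have "compactin mtopology (chain_ball M d x \<epsilon>)"
    using compactin_if_less_f_c[OF _ \<epsilon>(2)] chain_ball_eq[OF chain_ball_step[OF assms]] by metis
  then show False
    using f_c_ge[of \<epsilon> x] \<open>0 < \<epsilon>\<close> \<epsilon>(1) by (auto dest: leD)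
qed

text \<open>For \<open>\<epsilon> > b\<close>, a point of \<open>S\<close> within \<open>\<epsilon>\<close> of \<open>y\<close> bounds \<open>f_c y\<close> by \<open>\<epsilon>\<close>.\<close>

lemma f_c_closure_le:
  assumes "S \<subseteq> M" and "\<And>x. x \<in> S \<Longrightarrow> f_c M d x \<le> b" and "y \<in> mtopology closure_of S" and "0 \<le> b"
  shows "f_c M d y \<le> b"
proof (rule ccontr)
  assume "\<not> ?thesis"
  then have "b < f_c M d y"
    by (simp only: not_le)
  from ereal_dense2[OF this] obtain \<epsilon> where \<epsilon>: "b < ereal \<epsilon>" "ereal \<epsilon> < f_c M d y"
    by blast
  then have "0 < ereal \<epsilon>"
    using assms(4) by (meson le_less_trans)
  then obtain x where x: "x \<in> S" "x \<in> mball y \<epsilon>"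
    using assms(3) by (auto simp: metric_closure_of)
  have "f_c M d y \<le> max (f_c M d x) (ereal (d x y))"
    using x assms(1) by (intro f_c_le_max) auto
  also have "\<dots> \<le> max b (ereal \<epsilon>)"
    using x assms(2) by (intro max.mono) (auto simp: commute[of x])
  finally show False
    using \<epsilon> by (simp add: max_def split: if_splits)
qed

lemma closedin_nslc: "closedin mtopology (nslc M d)"
proof -
  have "mtopology closure_of (nslc M d) \<subseteq> nslc M d"
  proof
    fix y assume y: "y \<in> mtopology closure_of (nslc M d)"
    have "f_c M d y \<le> 0"
      by (rule f_c_closure_le[OF _ _ y]) (auto simp: nslc_def)
    then show "y \<in> nslc M d"
      using y f_c_nonneg[of y] by (simp add: nslc_def metric_closure_of)
  qed
  moreover have "nslc M d \<subseteq> M"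
    by (auto simp: nslc_def)
  ultimately show ?thesis
    by (metis closedin_closure_of closure_of_subset subset_antisym topspace_mtopology)
qed

text \<open>By \<open>f_c_le_max\<close>, the value \<open>f_c x\<close> is at most the maximum of \<open>f_c (\<sigma> n)\<close> and \<open>d (\<sigma> n) x\<close>,
  which are both small for infinitely many \<open>n\<close>.\<close>

lemma cluster_point_in_nslc:
  assumes "range \<sigma> \<subseteq> M" and lim: "(\<lambda>n. f_c M d (\<sigma> n)) \<longlonglongrightarrow> 0" and x: "cluster_point mtopology \<sigma> x"
  shows "x \<in> nslc M d"
proof -
  have xM: "x \<in> M"
    using x cluster_point_metric by blast
  have "f_c M d x \<le> ereal e" if "0 < e" for e :: real
  proof -
    have "eventually (\<lambda>n. f_c M d (\<sigma> n) < ereal e) sequentially"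
      using lim that by (intro order_tendstoD(2)) auto
    then obtain N where N: "\<And>n. n \<ge> N \<Longrightarrow> f_c M d (\<sigma> n) < ereal e"
      by (auto simp: eventually_sequentially)
    have "infinite {n. \<sigma> n \<in> mball x e}"
      using x that unfolding cluster_point_metric by blast
    then obtain n where "n \<ge> N" "\<sigma> n \<in> mball x e"
      unfolding infinite_nat_iff_unbounded_le by blast
    have "f_c M d x \<le> max (f_c M d (\<sigma> n)) (ereal (d (\<sigma> n) x))"
      using assms(1) xM by (intro f_c_le_max) auto
    also have "\<dots> \<le> ereal e"
      using N[OF \<open>n \<ge> N\<close>] \<open>\<sigma> n \<in> mball x e\<close> by (simp add: commute[of x])
    finally show ?thesis .
  qed
  then have "f_c M d x \<le> 0"
    using ereal_le_epsilon2[of "f_c M d x" 0] by simp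
  then show ?thesis
    using xM f_c_nonneg[of x] by (simp add: nslc_def)
qed

section \<open>Cofinally Bourbaki quasi-Cauchy sequences and the modulus of compactness\<close>

lemma reindexing_le_inverse:
  fixes g :: "'b \<Rightarrow> ereal"
  assumes "\<And>e m. e > 0 \<Longrightarrow> \<exists>n\<ge>m. g (\<sigma> n) \<le> ereal e"
  obtains r :: "nat \<Rightarrow> nat" where "\<And>k. k \<le> r k" and "\<And>k. g (\<sigma> (r k)) \<le> ereal (inverse (Suc k))"
proof -
  have "\<exists>r. \<forall>k::nat. r k \<ge> k \<and> g (\<sigma> (r k)) \<le> ereal (inverse (Suc k))"
    by (intro choice allI) (simp add: assms)
  then show thesis
    using that by blast
qed

lemma tendsto_zero_if_le_inverse:
  fixes g :: "nat \<Rightarrow> ereal"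
  assumes "\<And>k. 0 \<le> g k" and "\<And>k. g k \<le> ereal (inverse (Suc k))"
  shows "g \<longlonglongrightarrow> 0"
proof (rule tendsto_sandwich[where f = "\<lambda>_. 0" and h = "\<lambda>k. ereal (inverse (Suc k))"])
  show "(\<lambda>k. ereal (inverse (Suc k))) \<longlonglongrightarrow> 0"
    using LIMSEQ_inverse_real_of_nat by (simp add: zero_ereal_def)
qed (use assms in auto)

text \<open>If the sequence is itself cofinally Bourbaki quasi-Cauchy there is nothing to
  show. Otherwise each component at some scale \<open>m\<close> contains only finitely many terms. After
  reindexing, the \<open>k\<close>-th term \<open>\<tau> k\<close> has a noncompact component at the scale \<open>2 / (k + 1)\<close>, which
  contains a sequence \<open>\<upsilon> k\<close> without cluster point. The interleaving \<open>z\<close> of these sequences is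
  cofinally Bourbaki quasi-Cauchy. But \<open>z\<close> has no cluster point: an \<open>m\<close>-component meets the
  sequence \<open>\<upsilon> k\<close> for only finitely many \<open>k\<close>, because as soon as \<open>2 / (k + 1) \<le> m\<close> it then contains
  \<open>\<tau> k\<close>.\<close>

lemma f_c_null_cluster_point:
  assumes H: "\<And>\<sigma>. cofinally_Bourbaki_quasi_Cauchy M d \<sigma> \<Longrightarrow> \<exists>x. cluster_point mtopology \<sigma> x"
    and \<sigma>: "range \<sigma> \<subseteq> M" and lim: "(\<lambda>n. f_c M d (\<sigma> n)) \<longlonglongrightarrow> 0"
  shows "\<exists>x. cluster_point mtopology \<sigma> x"
proof -
  have "\<exists>n\<ge>m. f_c M d (\<sigma> n) \<le> ereal e" if "e > 0" for e m
  proof -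
    have "eventually (\<lambda>n. f_c M d (\<sigma> n) < ereal e \<and> m \<le> n) sequentially"
      using lim that by (intro eventually_conj order_tendstoD(2) eventually_ge_at_top) auto
    then obtain n where "f_c M d (\<sigma> n) < ereal e \<and> m \<le> n"
      using eventually_happens'[OF sequentially_bot] by blast
    then show ?thesis
      using less_imp_le by blast
  qed
  then obtain r where r: "\<And>k. k \<le> r k" "\<And>k. f_c M d (\<sigma> (r k)) \<le> ereal (inverse (Suc k))"
    using reindexing_le_inverse[of "f_c M d" \<sigma>] by metis
  define \<tau> where "\<tau> = \<sigma> \<circ> r"
  \<comment> \<open>Twice the bound on \<open>f_c\<close>: noncompactness is guaranteed only strictly above \<open>f_c\<close>.\<close>
  define C where "C k = chain_ball M d (\<tau> k) (2 / Suc k)" for k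
  have \<tau>M: "\<tau> k \<in> M" for k
    using \<sigma> by (auto simp: \<tau>_def)
  have "\<not> compactin mtopology (C k)" for k
  proof
    assume "compactin mtopology (C k)"
    then have "ereal (2 / Suc k) \<le> f_c M d (\<tau> k)"
      unfolding C_def by (intro f_c_ge) auto
    also have "\<dots> \<le> ereal (inverse (Suc k))"
      using r(2) by (simp add: \<tau>_def)
    finally show False
      by (simp add: divide_simps)
  qed
  moreover have "closedin mtopology (C k)" for k
    unfolding C_def by (intro closedin_chain_ball) simp
  ultimately have "\<exists>\<upsilon>. range \<upsilon> \<subseteq> C k \<and> (\<forall>x. \<not> cluster_point mtopology \<upsilon> x)" for k
    by (meson compactin_if_cluster_points)
  then obtain \<upsilon> where \<upsilon>: "\<And>k. range (\<upsilon> k) \<subseteq> C k" "\<And>k x. \<not> cluster_point mtopology (\<upsilon> k) x"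
    by metis
  have \<upsilon>M: "\<upsilon> k i \<in> M" for k i
    using \<upsilon>(1)[of k] chain_ball_subset unfolding C_def by blast
  have \<tau>_range: "range \<tau> \<subseteq> M"
    using \<tau>M by blast
  have "\<exists>x. cluster_point mtopology \<tau> x"
  proof (cases "cofinally_Bourbaki_quasi_Cauchy M d \<tau>")
    case False
    then obtain m where m: "m > 0"
        and no: "\<not> (\<exists>N p. infinite N \<and> p \<in> M \<and> (\<forall>n\<in>N. \<tau> n \<in> chain_ball M d p m))"
      using \<tau>_range unfolding cofinally_Bourbaki_quasi_Cauchy_def by blast
    have fin: "finite {k. \<tau> k \<in> chain_ball M d p m}" if "p \<in> M" for p
      using no that by (metis mem_Collect_eq)
    define z where "z i = \<upsilon> (fst (prod_decode i)) (snd (prod_decode i))" for i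
    have "cofinally_Bourbaki_quasi_Cauchy M d z"
      unfolding cofinally_Bourbaki_quasi_Cauchy_def
    proof (intro conjI allI impI)
      show "range z \<subseteq> M"
        using \<upsilon>M by (auto simp: z_def)
      fix \<epsilon> :: real assume "\<epsilon> > 0"
      then obtain k where "inverse (Suc k) < \<epsilon> / 2"
        using reals_Archimedean[of "\<epsilon> / 2"] by auto
      then have k: "2 / Suc k \<le> \<epsilon>"
        by (simp add: field_simps)
      define N where "N = range (\<lambda>i. prod_encode (k, i))"
      have "infinite N"
        unfolding N_def by (intro range_inj_infinite) (auto simp: inj_def)
      moreover have "\<upsilon> k i \<in> chain_ball M d (\<tau> k) \<epsilon>" for i
        using \<upsilon>(1)[of k] chain_ball_mono[OF k, of "\<tau> k"] unfolding C_def by blast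
      then have "z n \<in> chain_ball M d (\<tau> k) \<epsilon>" if "n \<in> N" for n
        using that by (auto simp: N_def z_def)
      ultimately show "\<exists>N p. infinite N \<and> p \<in> M \<and> (\<forall>n\<in>N. z n \<in> chain_ball M d p \<epsilon>)"
        using \<tau>M by blast
    qed
    then obtain w where w: "cluster_point mtopology z w"
      using H by blast
    then have wM: "w \<in> M"
      by (simp add: cluster_point_metric)
    obtain k0 where k0: "inverse (Suc k0) < m / 2"
      using reals_Archimedean[of "m / 2"] m by auto
    define F where "F = {..k0} \<union> {k. \<tau> k \<in> chain_ball M d w m}"
    have finF: "finite F"
      using fin[OF wM] by (simp add: F_def)
    have F: "k \<in> F" if "\<upsilon> k i \<in> chain_ball M d w m" for k i
    proof (cases "k \<le> k0")
      case False
      then have "2 / Suc k \<le> 2 / Suc k0"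
        by (intro divide_left_mono) auto
      moreover have "2 / Suc k0 \<le> m"
        using k0 by (simp add: field_simps)
      ultimately have "2 / Suc k \<le> m"
        by (rule order_trans)
      then have "\<upsilon> k i \<in> chain_ball M d (\<tau> k) m"
        using \<upsilon>(1)[of k] chain_ball_mono[of "2 / Suc k" m "\<tau> k"] by (auto simp: C_def)
      then have "\<tau> k \<in> chain_ball M d w m"
        using that by (meson chain_ball_sym chain_ball_trans)
      then show ?thesis
        by (simp add: F_def)
    qed (simp add: F_def)
    have "\<exists>U. openin mtopology U \<and> w \<in> U \<and> finite {i. \<upsilon> k i \<in> U}" for k
      using \<upsilon>(2)[of k w] wM by (auto simp: cluster_point_def)
    then obtain U where U: "\<And>k. openin mtopology (U k)" "\<And>k. w \<in> U k" "\<And>k. finite {i. \<upsilon> k i \<in> U k}"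
      by metis
    define V where "V = chain_ball M d w m \<inter> ((\<Inter>k\<in>F. U k) \<inter> M)"
    have "openin mtopology V"
      unfolding V_def
      by (rule openin_Int) (use openin_INT[of F mtopology U] finF U(1) openin_chain_ball[OF m] in auto)
    moreover have "w \<in> V"
      using U(2) wM chain_ball_refl by (auto simp: V_def)
    moreover have "{n. z n \<in> V} \<subseteq> prod_encode ` (SIGMA k:F. {i. \<upsilon> k i \<in> U k})"
    proof
      fix n assume n: "n \<in> {n. z n \<in> V}"
      obtain k i where ki: "prod_decode n = (k, i)"
        by fastforce
      then have zn: "z n = \<upsilon> k i"
        by (simp add: z_def)
      then have "k \<in> F"
        using n F[of k i] by (simp add: V_def)
      then have "\<upsilon> k i \<in> U k"
        using n zn by (auto simp: V_def)
      then show "n \<in> prod_encode ` (SIGMA k:F. {i. \<upsilon> k i \<in> U k})"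
        using \<open>k \<in> F\<close> arg_cong[OF ki, of prod_encode]
        by (intro image_eqI[where x = "(k, i)"]) simp_all
    qed
    then have "finite {n. z n \<in> V}"
      using finF U(3) by (meson finite_SigmaI finite_imageI finite_subset)
    ultimately show ?thesis
      using w by (auto simp: cluster_point_def)
  qed (use H in blast)
  then obtain x where "cluster_point mtopology (\<sigma> \<circ> r) x"
    unfolding \<tau>_def by blast
  then have "cluster_point mtopology \<sigma> x"
    using r(1) by (rule cluster_point_compose)
  then show ?thesis ..
qed

section \<open>Decreasing sequences of closed sets\<close>

text \<open>Points \<open>\<sigma> k \<in> A k\<close> with \<open>f_c (\<sigma> k)\<close> near the infimum have a cluster point, which lies in
  every \<open>A n\<close> because the sets are closed and decrease.\<close>

lemma Inter_nonempty_if_f_c_null_cluster: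
  assumes H: "\<And>\<sigma>. range \<sigma> \<subseteq> M \<Longrightarrow> (\<lambda>n. f_c M d (\<sigma> n)) \<longlonglongrightarrow> 0 \<Longrightarrow> \<exists>x. cluster_point mtopology \<sigma> x"
    and A: "\<And>n. closedin mtopology (A n)" "\<And>n. A n \<noteq> {}" "decseq A"
    and lim: "(\<lambda>n. INF x\<in>A n. f_c M d x) \<longlonglongrightarrow> 0"
  shows "(\<Inter>n. A n) \<noteq> {}"
proof -
  have AM: "A n \<subseteq> M" for n
    using A(1) closedin_subset by fastforce
  have "\<exists>n\<ge>k. \<exists>x\<in>A n. f_c M d x \<le> ereal (inverse (Suc k))" for k :: nat
  proof -
    have "eventually (\<lambda>n. (INF x\<in>A n. f_c M d x) < ereal (inverse (Suc k)) \<and> k \<le> n) sequentially"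
      using lim by (intro eventually_conj order_tendstoD(2) eventually_ge_at_top) auto
    then obtain n where "(INF x\<in>A n. f_c M d x) < ereal (inverse (Suc k)) \<and> k \<le> n"
      using eventually_happens'[OF sequentially_bot] by blast
    then show ?thesis
      by (auto simp: Inf_less_iff intro: less_imp_le)
  qed
  then have "\<exists>x\<in>A k. f_c M d x \<le> ereal (inverse (Suc k))" for k
    using decseqD[OF A(3)] by (meson subsetD)
  then obtain \<sigma> where \<sigma>: "\<And>k. \<sigma> k \<in> A k" "\<And>k. f_c M d (\<sigma> k) \<le> ereal (inverse (Suc k))"
    by metis
  have "(\<lambda>k. f_c M d (\<sigma> k)) \<longlonglongrightarrow> 0"
    by (rule tendsto_zero_if_le_inverse) (use \<sigma>(2) f_c_nonneg in auto)
  then obtain x where x: "cluster_point mtopology \<sigma> x"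
    using H[of \<sigma>] \<sigma>(1) AM by blast
  have "x \<in> A n" for n
  proof (rule ccontr)
    assume "x \<notin> A n"
    then have "x \<in> M - A n"
      using x by (simp add: cluster_point_metric)
    moreover have "openin mtopology (M - A n)"
      using A(1) by (simp add: closedin_def)
    ultimately have "infinite {k. \<sigma> k \<in> M - A n}"
      using x unfolding cluster_point_def by blast
    moreover have "{k. \<sigma> k \<in> M - A n} \<subseteq> {..<n}"
    proof
      fix k assume "k \<in> {k. \<sigma> k \<in> M - A n}"
      then show "k \<in> {..<n}"
        using \<sigma>(1)[of k] decseqD[OF A(3), of n k] by (cases "n \<le> k") auto
    qed
    ultimately show False
      using finite_subset by blast
  qed
  then show ?thesis
    by blast
qed

text \<open>The closures of the tails of a sequence intersect in its cluster points, and passing to a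
  closure does not increase an upper bound of \<open>f_c\<close>.\<close>

lemma f_c_null_cluster_if_Inter_nonempty:
  assumes H: "\<And>A. (\<And>n. closedin mtopology (A n)) \<Longrightarrow> (\<And>n. A n \<noteq> {}) \<Longrightarrow> decseq A \<Longrightarrow>
      (\<lambda>n. SUP x\<in>A n. f_c M d x) \<longlonglongrightarrow> 0 \<Longrightarrow> (\<Inter>n. A n) \<noteq> {}"
    and \<sigma>: "range \<sigma> \<subseteq> M" and lim: "(\<lambda>n. f_c M d (\<sigma> n)) \<longlonglongrightarrow> 0"
  shows "\<exists>x. cluster_point mtopology \<sigma> x"
proof -
  define A where "A n = mtopology closure_of (\<sigma> ` {n..})" for n
  have sub: "\<sigma> ` {n..} \<subseteq> A n" for n
    unfolding A_def using \<sigma> by (intro closure_of_subset) auto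
  have "(\<Inter>n. A n) \<noteq> {}"
  proof (rule H)
    show "closedin mtopology (A n)" for n
      by (simp add: A_def)
    show "A n \<noteq> {}" for n
      using sub[of n] by auto
    show "decseq A"
      unfolding A_def by (intro antimonoI closure_of_mono image_mono) auto
    show "(\<lambda>n. SUP x\<in>A n. f_c M d x) \<longlonglongrightarrow> 0"
    proof (rule order_tendstoI)
      fix a :: ereal assume "a < 0"
      have "0 \<le> (SUP x\<in>A n. f_c M d x)" for n
        using sub[of n] f_c_nonneg[of "\<sigma> n"] by (intro SUP_upper2[of "\<sigma> n"]) auto
      then show "\<forall>\<^sub>F n in sequentially. a < (SUP x\<in>A n. f_c M d x)"
        by (intro always_eventually allI less_le_trans[OF \<open>a < 0\<close>])
    next
      fix a :: ereal assume "0 < a"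
      then obtain b where b: "0 < b" "b < a"
        using dense by blast
      obtain N where N: "\<And>n. n \<ge> N \<Longrightarrow> f_c M d (\<sigma> n) < b"
        using order_tendstoD(2)[OF lim b(1)] by (auto simp: eventually_sequentially)
      have "(SUP x\<in>A n. f_c M d x) \<le> b" if "n \<ge> N" for n
      proof (rule SUP_least)
        fix y assume "y \<in> A n"
        then have y: "y \<in> mtopology closure_of (\<sigma> ` {n..})"
          by (simp add: A_def)
        show "f_c M d y \<le> b"
        proof (rule f_c_closure_le[OF _ _ y])
          fix x assume "x \<in> \<sigma> ` {n..}"
          then obtain k where "x = \<sigma> k" "k \<ge> n"
            by auto
          then show "f_c M d x \<le> b"
            using N[of k] that by simp
        qed (use \<sigma> b in auto)
      qed
      then show "\<forall>\<^sub>F n in sequentially. (SUP x\<in>A n. f_c M d x) < a"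
        unfolding eventually_sequentially using le_less_trans[OF _ b(2)] by metis
    qed
  qed
  then obtain x where x: "\<And>n. x \<in> A n"
    by blast
  have "cluster_point mtopology \<sigma> x"
    unfolding cluster_point_metric infinite_nat_iff_unbounded_le
  proof (intro conjI allI impI)
    show "x \<in> M"
      using x[of 0] by (simp add: A_def metric_closure_of)
    fix e :: real and m assume "e > 0"
    then show "\<exists>n\<ge>m. n \<in> {n. \<sigma> n \<in> mball x e}"
      using x[of m] unfolding A_def metric_closure_of by blast
  qed
  then show ?thesis
    by blast
qed

section \<open>Uniform local component boundedness of continuous functions\<close>

lemma continuous_map_real_if_nonexpansive:
  assumes "\<And>x y. x \<in> M \<Longrightarrow> y \<in> M \<Longrightarrow> h x \<le> h y + d x y"
  shows "continuous_map mtopology euclideanreal h"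
  unfolding continuous_map_from_metric
proof (intro conjI ballI allI impI)
  fix a U assume a: "a \<in> M" and U: "openin euclideanreal U \<and> h a \<in> U"
  then obtain r where r: "r > 0" "ball (h a) r \<subseteq> U"
    by (auto simp: open_contains_ball)
  have "h x \<in> U" if "x \<in> M" "d a x < r" for x
  proof -
    have "\<bar>h a - h x\<bar> < r"
      using assms[OF a that(1)] assms[OF that(1) a] that(2) by (simp add: commute)
    then show ?thesis
      using r(2) by (auto simp: dist_real_def)
  qed
  then show "\<exists>r>0. \<forall>x. x \<in> M \<and> d a x < r \<longrightarrow> h x \<in> U"
    using r(1) by blast
qed auto

text \<open>The infimum \<open>h x\<close> of the numbers \<open>d x (\<sigma> n) + 1 / (n + 1)\<close> depends on \<open>x\<close> with
  Lipschitz constant one, it is at most \<open>1 / (n + 1)\<close> at \<open>\<sigma> n\<close>, and it vanishes only at cluster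
  points. Hence its reciprocal is continuous and at least \<open>n + 1\<close> at \<open>\<sigma> n\<close>.\<close>

lemma continuous_map_unbounded_on_sequence:
  assumes \<sigma>: "range \<sigma> \<subseteq> M" and no: "\<And>x. \<not> cluster_point mtopology \<sigma> x"
  obtains f where "continuous_map mtopology euclideanreal f" and "\<And>n. real n \<le> f (\<sigma> n)"
proof -
  define h where "h x = (INF n. d x (\<sigma> n) + inverse (Suc n))" for x
  have bdd: "bdd_below (range (\<lambda>n. d x (\<sigma> n) + inverse (Suc n)))" for x
    by (intro bdd_belowI[where m = 0]) (auto intro!: add_nonneg_nonneg)
  have h_le: "h x \<le> d x (\<sigma> n) + inverse (Suc n)" for x n
    unfolding h_def by (intro cINF_lower bdd) simp
  have \<sigma>M: "\<sigma> n \<in> M" for n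
    using \<sigma> by blast
  have "h x \<le> h y + d x y" if xy: "x \<in> M" "y \<in> M" for x y
  proof -
    have "h x - d x y \<le> h y"
      unfolding h_def[of y]
    proof (rule cINF_greatest)
      fix n
      show "h x - d x y \<le> d y (\<sigma> n) + inverse (Suc n)"
        using h_le[of x n] triangle[OF xy \<sigma>M[of n]] by linarith
    qed simp
    then show ?thesis
      by linarith
  qed
  then have cont: "continuous_map mtopology euclideanreal h"
    by (rule continuous_map_real_if_nonexpansive)
  have pos: "0 < h x" if x: "x \<in> M" for x
  proof (rule ccontr)
    assume "\<not> 0 < h x"
    have "infinite {n. \<sigma> n \<in> mball x e}" if "e > 0" for e
      unfolding infinite_nat_iff_unbounded_le
    proof
      fix m
      define c where "c = min e (inverse (Suc m))"
      have "c > 0"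
        using that by (simp add: c_def)
      then have "h x < c"
        using \<open>\<not> 0 < h x\<close> by linarith
      then obtain n where n: "d x (\<sigma> n) + inverse (Suc n) < c"
        unfolding h_def cINF_less_iff[OF UNIV_not_empty bdd] by blast
      have ipos: "0 < inverse (real (Suc n))"
        by simp
      have "d x (\<sigma> n) < e"
        using n ipos unfolding c_def by linarith
      moreover have "inverse (real (Suc n)) < inverse (real (Suc m))"
        using n nonneg[of x "\<sigma> n"] unfolding c_def by linarith
      then have "m \<le> n"
        by simp
      ultimately show "\<exists>n\<ge>m. n \<in> {n. \<sigma> n \<in> mball x e}"
        using x \<sigma>M by (intro exI[of _ n]) simp
    qed
    then show False
      using no[of x] x unfolding cluster_point_metric by simp
  qed
  show thesis
  proof
    show "continuous_map mtopology euclideanreal (\<lambda>x. inverse (h x))"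
    proof (rule continuous_map_real_inverse[OF cont])
      fix x assume "x \<in> topspace mtopology"
      then show "h x \<noteq> 0"
        using pos[of x] by simp
    qed
    fix n
    have "h (\<sigma> n) \<le> inverse (Suc n)"
      using h_le[of "\<sigma> n" n] \<sigma>M[of n] by simp
    then have "inverse (inverse (real (Suc n))) \<le> inverse (h (\<sigma> n))"
      using pos[OF \<sigma>M[of n]] by (intro le_imp_inverse_le)
    then show "real n \<le> inverse (h (\<sigma> n))"
      by simp
  qed
qed

text \<open>A function that grows along \<open>\<sigma>\<close> is unbounded on every component that contains infinitely
  many terms of \<open>\<sigma>\<close>, and there is such a component at every scale.\<close>

lemma ulcb_imp_cofinally_BqC_cluster:
  assumes H: "\<And>f. continuous_map mtopology euclideanreal f \<Longrightarrow>
      unif_loc_component_bounded M d (UNIV :: real set) dist f M"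
    and B: "cofinally_Bourbaki_quasi_Cauchy M d \<sigma>"
  shows "\<exists>x. cluster_point mtopology \<sigma> x"
proof (rule ccontr)
  assume "\<not> ?thesis"
  moreover have "range \<sigma> \<subseteq> M"
    using B by (simp add: cofinally_Bourbaki_quasi_Cauchy_def)
  ultimately obtain f where f: "continuous_map mtopology euclideanreal f" "\<And>n. real n \<le> f (\<sigma> n)"
    using continuous_map_unbounded_on_sequence by metis
  obtain \<delta> where \<delta>: "\<delta> > 0" "\<And>a. a \<in> M \<Longrightarrow> bounded (f ` chain_ball M d a \<delta>)"
    using H[OF f(1)] by (auto simp: unif_loc_component_bounded_def)
  have "\<exists>N p. infinite N \<and> p \<in> M \<and> (\<forall>n\<in>N. \<sigma> n \<in> chain_ball M d p \<delta>)"
    using B \<delta>(1) by (simp only: cofinally_Bourbaki_quasi_Cauchy_def)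
  then obtain N p where N: "infinite N" "p \<in> M" "\<And>n. n \<in> N \<Longrightarrow> \<sigma> n \<in> chain_ball M d p \<delta>"
    by blast
  obtain b where b: "\<And>y. y \<in> chain_ball M d p \<delta> \<Longrightarrow> norm (f y) \<le> b"
    using \<delta>(2)[OF N(2)] unfolding bounded_iff by blast
  obtain k :: nat where k: "b < real k"
    using reals_Archimedean2 by blast
  obtain n where n: "n \<ge> k" "n \<in> N"
    using N(1) unfolding infinite_nat_iff_unbounded_le by blast
  have "real n \<le> b"
    using b[OF N(3)[OF n(2)]] f(2)[of n] by simp
  then show False
    using k n(1) by simp
qed

text \<open>The preimages of the concentric balls of integer radius form a directed open cover.\<close>

lemma directed_refinement_imp_ulcb:
  assumes H: "\<And>\<V>. open_cover mtopology \<V> \<Longrightarrow> directed_by_inclusion \<V> \<Longrightarrow>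
      \<exists>\<mu>>0. cover_refines ((\<lambda>x. chain_ball M d x \<mu>) ` M) \<V>"
    and Y: "Metric_space Y \<rho>" and f: "continuous_map mtopology (mtop Y \<rho>) f"
  shows "unif_loc_component_bounded M d Y \<rho> f M"
proof (cases "M = {}")
  case True
  then show ?thesis
    by (auto simp: unif_loc_component_bounded_def intro: exI[of _ 1])
next
  case False
  interpret Y: Metric_space Y \<rho>
    by (fact Y)
  have fY: "f x \<in> Y" if "x \<in> M" for x
    using continuous_map_image_subset_topspace[OF f] that by auto
  obtain y where y: "y \<in> Y"
    using False fY by blast
  define V where "V n = {x \<in> topspace mtopology. f x \<in> Y.mball y (real n)}" for n
  have V_mono: "V m \<subseteq> V n" if "m \<le> n" for m n
    using Y.mball_subset_concentric[of "real m" "real n" y] that by (auto simp: V_def)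
  have "open_cover mtopology (range V)"
    unfolding open_cover_def
  proof (intro conjI ballI)
    fix W assume "W \<in> range V"
    then obtain n where "W = V n"
      by blast
    then show "openin mtopology W"
      unfolding V_def using openin_continuous_map_preimage[OF f Y.openin_mball] by simp
  next
    have "\<exists>n. x \<in> V n" if "x \<in> M" for x
      using reals_Archimedean2[of "\<rho> y (f x)"] that fY[OF that] y by (auto simp: V_def)
    moreover have "V n \<subseteq> M" for n
      by (auto simp: V_def)
    ultimately show "\<Union> (range V) = topspace mtopology"
      by fastforce
  qed
  moreover have "directed_by_inclusion (range V)"
    unfolding directed_by_inclusion_def
  proof (intro ballI)
    fix A B assume "A \<in> range V" "B \<in> range V"
    then obtain m n where "A = V m" "B = V n"
      by blast
    then have "A \<union> B \<subseteq> V (max m n)"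
      using V_mono[of m "max m n"] V_mono[of n "max m n"] by simp
    then show "\<exists>W\<in>range V. A \<union> B \<subseteq> W"
      by blast
  qed
  ultimately obtain \<mu> where \<mu>: "\<mu> > 0" "cover_refines ((\<lambda>x. chain_ball M d x \<mu>) ` M) (range V)"
    using H by blast
  have "Y.mbounded (f ` chain_ball M d a \<mu>)" if "a \<in> M" for a
  proof -
    have "\<exists>n. chain_ball M d a \<mu> \<subseteq> V n"
      using \<mu>(2) that unfolding cover_refines_def by blast
    then obtain n where "chain_ball M d a \<mu> \<subseteq> V n" ..
    then have "f ` chain_ball M d a \<mu> \<subseteq> Y.mball y (real n)"
      unfolding V_def by blast
    then show ?thesis
      using Y.mbounded_subset[OF Y.mbounded_mball] by blast
  qed
  then show ?thesis
    using \<mu>(1) unfolding unif_loc_component_bounded_def by blast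
qed

text \<open>This metric makes boundedness of a set imply boundedness of \<open>f\<close> on it.\<close>

lemma equivalent_metric_add_continuous:
  assumes f: "continuous_map mtopology euclideanreal f"
  defines "\<rho> \<equiv> \<lambda>x y. d x y + \<bar>f x - f y\<bar>"
  shows "Metric_space M \<rho>" and "mtop M \<rho> = mtopology"
proof -
  show "Metric_space M \<rho>"
  proof
    show "0 \<le> \<rho> x y" for x y
      by (simp add: \<rho>_def)
    show "\<rho> x y = \<rho> y x" for x y
      by (simp add: \<rho>_def commute abs_minus_commute)
    show "\<rho> x y = 0 \<longleftrightarrow> x = y" if "x \<in> M" "y \<in> M" for x y
      using zero[OF that] nonneg[of x y] by (auto simp: \<rho>_def add_nonneg_eq_0_iff)
    show "\<rho> x z \<le> \<rho> x y + \<rho> y z" if "x \<in> M" "y \<in> M" "z \<in> M" for x y z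
      using triangle[OF that] unfolding \<rho>_def by linarith
  qed
  then interpret \<rho>: Metric_space M \<rho> .
  have 1: "\<rho>.mball x r \<subseteq> mball x r" for x r
    unfolding subset_iff \<rho>.in_mball in_mball by (auto simp: \<rho>_def)
  have 2: "\<exists>s>0. mball x s \<subseteq> \<rho>.mball x r" if "x \<in> M" "r > 0" for x r
  proof -
    have "openin euclideanreal (ball (f x) (r / 2)) \<and> f x \<in> ball (f x) (r / 2)"
      using that(2) by simp
    then have "\<exists>s>0. \<forall>y. y \<in> M \<and> d x y < s \<longrightarrow> f y \<in> ball (f x) (r / 2)"
      using f that(1) unfolding continuous_map_from_metric by blast
    then obtain s where s: "s > 0" "\<And>y. y \<in> M \<Longrightarrow> d x y < s \<Longrightarrow> f y \<in> ball (f x) (r / 2)"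
      by blast
    have "mball x (min s (r / 2)) \<subseteq> \<rho>.mball x r"
    proof
      fix y assume "y \<in> mball x (min s (r / 2))"
      then show "y \<in> \<rho>.mball x r"
        using s(2)[of y] unfolding \<rho>.in_mball by (simp add: \<rho>_def dist_real_def)
    qed
    then show ?thesis
      using s(1) that(2) by (intro exI[of _ "min s (r / 2)"]) simp
  qed
  have "openin \<rho>.mtopology U \<longleftrightarrow> openin mtopology U" for U
    unfolding openin_mtopology \<rho>.openin_mtopology
    using 1 2 by (meson order_trans subsetD)
  then show "mtop M \<rho> = mtopology"
    by (simp add: topology_eq)
qed

lemma equivalent_metrics_bounded_imp_ulcb:
  assumes H: "\<And>\<rho>. Metric_space M \<rho> \<Longrightarrow> mtop M \<rho> = mtopology \<Longrightarrow>
      \<exists>\<delta>>0. \<forall>x\<in>M. Metric_space.mbounded M \<rho> (chain_ball M d x \<delta>)"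
    and f: "continuous_map mtopology euclideanreal f"
  shows "unif_loc_component_bounded M d (UNIV :: real set) dist f M"
proof -
  define \<rho> where "\<rho> x y = d x y + \<bar>f x - f y\<bar>" for x y
  have \<rho>: "Metric_space M \<rho>" "mtop M \<rho> = mtopology"
    using equivalent_metric_add_continuous[OF f] by (simp_all add: \<rho>_def[abs_def])
  then obtain \<delta> where \<delta>: "\<delta> > 0" "\<And>x. x \<in> M \<Longrightarrow> Metric_space.mbounded M \<rho> (chain_ball M d x \<delta>)"
    using H by blast
  have "bounded (f ` chain_ball M d a \<delta>)" if a: "a \<in> M" for a
  proof -
    obtain b where b: "\<And>x. x \<in> chain_ball M d a \<delta> \<Longrightarrow> \<rho> x a \<le> b"
      using \<delta>(2)[OF a] chain_ball_refl[OF a, of \<delta>] unfolding Metric_space.mbounded_alt[OF \<rho>(1)] by blast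
    have "dist (f a) (f x) \<le> b" if "x \<in> chain_ball M d a \<delta>" for x
      using b[OF that] nonneg[of x a] unfolding \<rho>_def dist_real_def by linarith
    then show ?thesis
      unfolding bounded_def by blast
  qed
  then show ?thesis
    using \<delta>(1) by (auto simp: unif_loc_component_bounded_def)
qed

text \<open>The preimages of the intervals of length two centred at the integers form a locally finite
  open cover with \<open>f\<close> bounded on each member.\<close>

lemma locally_finite_imp_ulcb:
  assumes H: "\<And>\<U>. open_cover mtopology \<U> \<Longrightarrow> locally_finite_in mtopology \<U> \<Longrightarrow>
      \<exists>\<mu>>0. \<forall>x\<in>M. meets_finitely_many (chain_ball M d x \<mu>) \<U>"
    and f: "continuous_map mtopology euclideanreal f"
  shows "unif_loc_component_bounded M d (UNIV :: real set) dist f M"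
proof -
  have pre: "openin mtopology {x \<in> M. f x \<in> I}" if "open I" for I
    using openin_continuous_map_preimage[OF f, of I] that by simp
  define V where "V k = {x \<in> M. f x \<in> {of_int k - 1<..<of_int k + 1}}" for k :: int
  have cover: "x \<in> V \<lfloor>f x\<rfloor>" if "x \<in> M" for x
    using that by (auto simp: V_def) linarith
  have "open_cover mtopology (range V)"
    unfolding open_cover_def
  proof (intro conjI ballI)
    fix W assume "W \<in> range V"
    then obtain k where "W = V k"
      by blast
    then show "openin mtopology W"
      using pre[of "{of_int k - 1<..<of_int k + 1}"] by (simp add: V_def)
  next
    have "V k \<subseteq> M" for k
      by (auto simp: V_def)
    then show "\<Union> (range V) = topspace mtopology"
      using cover by fastforce
  qed
  moreover have "locally_finite_in mtopology (range V)"
    unfolding locally_finite_in_def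
  proof (intro conjI ballI)
    show "\<Union> (range V) \<subseteq> topspace mtopology"
      by (auto simp: V_def)
    fix a assume "a \<in> topspace mtopology"
    then have a: "a \<in> M"
      by simp
    define W where "W = {x \<in> M. f x \<in> {f a - 1<..<f a + 1}}"
    have "{U \<in> range V. U \<inter> W \<noteq> {}} \<subseteq> V ` {\<lfloor>f a\<rfloor> - 2..\<lfloor>f a\<rfloor> + 3}"
    proof
      fix U assume "U \<in> {U \<in> range V. U \<inter> W \<noteq> {}}"
      then obtain k x where U: "U = V k" and "x \<in> V k" "x \<in> W"
        by blast
      then have "k \<in> {\<lfloor>f a\<rfloor> - 2..\<lfloor>f a\<rfloor> + 3}"
        by (auto simp: V_def W_def) linarith+
      then show "U \<in> V ` {\<lfloor>f a\<rfloor> - 2..\<lfloor>f a\<rfloor> + 3}"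
        using U by blast
    qed
    then have "finite {U \<in> range V. U \<inter> W \<noteq> {}}"
      by (rule finite_subset) simp
    moreover have "openin mtopology W" "a \<in> W"
      using pre[of "{f a - 1<..<f a + 1}"] a by (simp_all add: W_def)
    ultimately show "\<exists>V'. openin mtopology V' \<and> a \<in> V' \<and> finite {U \<in> range V. U \<inter> V' \<noteq> {}}"
      by blast
  qed
  ultimately obtain \<mu> where \<mu>: "\<mu> > 0"
    "\<And>x. x \<in> M \<Longrightarrow> finite {U \<in> range V. chain_ball M d x \<mu> \<inter> U \<noteq> {}}"
    using H[of "range V"] unfolding meets_finitely_many_def by blast
  have bV: "bounded (f ` U)" if "U \<in> range V" for U
  proof -
    from that obtain k where "U = V k"
      by blast
    then have "f ` U \<subseteq> cball (of_int k) 1"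
      by (auto simp: V_def dist_real_def)
    then show ?thesis
      by (rule bounded_subset[OF bounded_cball])
  qed
  have "bounded (f ` chain_ball M d a \<mu>)" if a: "a \<in> M" for a
  proof -
    define \<F> where "\<F> = {U \<in> range V. chain_ball M d a \<mu> \<inter> U \<noteq> {}}"
    have "bounded (\<Union>U\<in>\<F>. f ` U)"
      using \<mu>(2)[OF a] bV by (intro bounded_UN) (auto simp: \<F>_def)
    moreover have "f ` chain_ball M d a \<mu> \<subseteq> (\<Union>U\<in>\<F>. f ` U)"
    proof
      fix y assume "y \<in> f ` chain_ball M d a \<mu>"
      then obtain x where x: "y = f x" "x \<in> chain_ball M d a \<mu>"
        by blast
      then have "x \<in> V \<lfloor>f x\<rfloor>"
        using cover chain_ball_subset by blast
      then show "y \<in> (\<Union>U\<in>\<F>. f ` U)"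
        using x unfolding \<F>_def by blast
    qed
    ultimately show ?thesis
      by (rule bounded_subset)
  qed
  then show ?thesis
    using \<mu>(1) by (auto simp: unif_loc_component_bounded_def)
qed

section \<open>Conditions on open covers\<close>

text \<open>Both parts apply the hypothesis to a suitable sequence. Points outside the enlargement with
  \<open>f_c\<close> tending to zero would cluster at a point of \<open>nslc\<close>, and so enter the enlargement.\<close>

lemma nslc_compact_and_uniform:
  assumes H: "\<And>\<sigma>. range \<sigma> \<subseteq> M \<Longrightarrow> (\<lambda>n. f_c M d (\<sigma> n)) \<longlonglongrightarrow> 0 \<Longrightarrow> \<exists>x. cluster_point mtopology \<sigma> x"
  shows "compactin mtopology (nslc M d)"
    and "0 < \<delta> \<Longrightarrow> \<exists>\<mu>>0. \<forall>x \<in> M - enlargement M d (nslc M d) \<delta>. ereal \<mu> < f_c M d x"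
proof -
  show "compactin mtopology (nslc M d)"
  proof (rule compactin_if_cluster_points[OF closedin_nslc])
    fix \<sigma> :: "nat \<Rightarrow> 'a" assume "range \<sigma> \<subseteq> nslc M d"
    then have "\<sigma> n \<in> M \<and> f_c M d (\<sigma> n) = 0" for n
      by (auto simp: nslc_def)
    then show "\<exists>x. cluster_point mtopology \<sigma> x"
      using H[of \<sigma>] by auto
  qed
  assume \<delta>: "0 < \<delta>"
  show "\<exists>\<mu>>0. \<forall>x \<in> M - enlargement M d (nslc M d) \<delta>. ereal \<mu> < f_c M d x"
  proof (rule ccontr)
    assume no: "\<not> ?thesis"
    have "\<exists>x. x \<in> M - enlargement M d (nslc M d) \<delta> \<and> f_c M d x \<le> ereal (inverse (Suc k))" for k
    proof -
      have "0 < inverse (real (Suc k))"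
        by simp
      then show ?thesis
        using no by (meson not_le)
    qed
    then obtain \<sigma> where \<sigma>: "\<And>k. \<sigma> k \<in> M - enlargement M d (nslc M d) \<delta>"
        "\<And>k. f_c M d (\<sigma> k) \<le> ereal (inverse (Suc k))"
      by metis
    have lim: "(\<lambda>k. f_c M d (\<sigma> k)) \<longlonglongrightarrow> 0"
      by (rule tendsto_zero_if_le_inverse) (use \<sigma>(2) f_c_nonneg in auto)
    have \<sigma>M: "range \<sigma> \<subseteq> M"
      using \<sigma>(1) by blast
    obtain x where x: "cluster_point mtopology \<sigma> x"
      using H[OF \<sigma>M lim] by blast
    then have xn: "x \<in> nslc M d"
      by (rule cluster_point_in_nslc[OF \<sigma>M lim])
    have "infinite {n. \<sigma> n \<in> mball x \<delta>}"
      using x \<delta> unfolding cluster_point_metric by blast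
    then obtain n where "\<sigma> n \<in> mball x \<delta>"
      using infinite_imp_nonempty by blast
    then have "\<sigma> n \<in> enlargement M d (nslc M d) \<delta>"
      using xn by (auto simp: enlargement_def commute)
    then show False
      using \<sigma>(1)[of n] by blast
  qed
qed

text \<open>Finitely many members cover a neighbourhood of \<open>nslc\<close>. A component at the scale \<open>\<mu>\<close> that
  is not contained in this neighbourhood has a point \<open>y\<close> with \<open>\<mu> < f_c y\<close>, hence is compact.\<close>

lemma chain_balls_finitely_covered:
  assumes comp: "compactin mtopology (nslc M d)"
    and unif: "\<And>\<delta>. 0 < \<delta> \<Longrightarrow>
      \<exists>\<mu>>0. \<forall>x \<in> M - enlargement M d (nslc M d) \<delta>. ereal \<mu> < f_c M d x"
    and \<V>: "open_cover mtopology \<V>"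
  shows "\<exists>\<mu>>0. \<forall>x\<in>M. \<exists>\<F>. finite \<F> \<and> \<F> \<subseteq> \<V> \<and> chain_ball M d x \<mu> \<subseteq> \<Union>\<F>"
proof -
  have fin: "\<exists>\<F>. finite \<F> \<and> \<F> \<subseteq> \<V> \<and> S \<subseteq> \<Union>\<F>" if "compactin mtopology S" for S
  proof -
    have "S \<subseteq> \<Union>\<V>"
      using \<V> that compactin_subset_topspace unfolding open_cover_def by blast
    then show ?thesis
      using that \<V> by (auto simp: compactin_def open_cover_def)
  qed
  obtain \<F>0 where \<F>0: "finite \<F>0" "\<F>0 \<subseteq> \<V>" "nslc M d \<subseteq> \<Union>\<F>0"
    using fin[OF comp] by blast
  have "openin mtopology (\<Union>\<F>0)"
    using \<V> \<F>0(2) by (intro openin_Union) (auto simp: open_cover_def)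
  then obtain \<delta> where \<delta>: "\<delta> > 0" "\<And>x. x \<in> nslc M d \<Longrightarrow> mball x \<delta> \<subseteq> \<Union>\<F>0"
    using lebesgue_number[OF comp, of "{\<Union>\<F>0}"] \<F>0(3) by auto
  have "enlargement M d (nslc M d) \<delta> \<subseteq> \<Union>\<F>0"
  proof
    fix y assume "y \<in> enlargement M d (nslc M d) \<delta>"
    then obtain b where "b \<in> nslc M d" "y \<in> mball b \<delta>"
      by (auto simp: enlargement_def nslc_def commute)
    then show "y \<in> \<Union>\<F>0"
      using \<delta>(2) by blast
  qed
  moreover obtain \<mu> where \<mu>: "\<mu> > 0"
      "\<And>x. x \<in> M - enlargement M d (nslc M d) \<delta> \<Longrightarrow> ereal \<mu> < f_c M d x"
    using unif[OF \<delta>(1)] by blast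
  ultimately have "\<exists>\<F>. finite \<F> \<and> \<F> \<subseteq> \<V> \<and> chain_ball M d x \<mu> \<subseteq> \<Union>\<F>" for x
  proof (cases "chain_ball M d x \<mu> \<subseteq> enlargement M d (nslc M d) \<delta>")
    case True
    then show ?thesis
      using \<open>enlargement M d (nslc M d) \<delta> \<subseteq> \<Union>\<F>0\<close> \<F>0 by (intro exI[of _ \<F>0]) auto
  next
    case False
    then obtain y where y: "y \<in> chain_ball M d x \<mu>" "y \<notin> enlargement M d (nslc M d) \<delta>"
      by blast
    then have "y \<in> M - enlargement M d (nslc M d) \<delta>"
      using chain_ball_subset by blast
    then have "compactin mtopology (chain_ball M d y \<mu>)"
      by (intro compactin_if_less_f_c \<mu>)
    then show ?thesis
      using fin chain_ball_eq[OF y(1)] by simp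
  qed
  then show ?thesis
    using \<mu>(1) by blast
qed

lemma directed_finite_subset:
  assumes "directed_by_inclusion \<V>" and "finite \<F>" and "\<F> \<subseteq> \<V>" and "\<F> \<noteq> {}"
  shows "\<exists>W\<in>\<V>. \<Union>\<F> \<subseteq> W"
  using assms(2,4,3)
proof (induction \<F> rule: finite_ne_induct)
  case (insert V \<F>)
  then obtain W where W: "W \<in> \<V>" "\<Union>\<F> \<subseteq> W" "V \<in> \<V>"
    by blast
  then obtain W' where W': "W' \<in> \<V>" "V \<union> W \<subseteq> W'"
    using assms(1) unfolding directed_by_inclusion_def by meson
  have "\<Union>(insert V \<F>) \<subseteq> W'"
    using W(2) W'(2) by auto
  then show ?case
    using W'(1) by blast
qed auto

lemma finitely_covered_imp_directed_refinement:
  assumes H: "\<exists>\<mu>>0. \<forall>x\<in>M. \<exists>\<F>. finite \<F> \<and> \<F> \<subseteq> \<V> \<and> chain_ball M d x \<mu> \<subseteq> \<Union>\<F>"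
    and dir: "directed_by_inclusion \<V>"
  shows "\<exists>\<mu>>0. cover_refines ((\<lambda>x. chain_ball M d x \<mu>) ` M) \<V>"
proof -
  obtain \<mu> where \<mu>: "\<mu> > 0"
    "\<forall>x\<in>M. \<exists>\<F>. finite \<F> \<and> \<F> \<subseteq> \<V> \<and> chain_ball M d x \<mu> \<subseteq> \<Union>\<F>"
    using H by blast
  have "\<exists>W\<in>\<V>. chain_ball M d x \<mu> \<subseteq> W" if x: "x \<in> M" for x
  proof -
    obtain \<F> where \<F>: "finite \<F>" "\<F> \<subseteq> \<V>" "chain_ball M d x \<mu> \<subseteq> \<Union>\<F>"
      using bspec[OF \<mu>(2) x] by blast
    then have "\<F> \<noteq> {}"
      using chain_ball_refl[OF x, of \<mu>] by auto
    then show ?thesis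
      using directed_finite_subset[OF dir \<F>(1,2)] \<F>(3) by (meson order_trans)
  qed
  then show ?thesis
    using \<mu>(1) by (auto simp: cover_refines_def)
qed

text \<open>Components at a fixed scale are open and partition the space. Each is cut into pieces along
  finitely many members of the given cover that cover it; then it meets no nonempty piece but its own.\<close>

lemma finitely_covered_imp_superparacompact:
  assumes H: "\<And>\<V>. open_cover mtopology \<V> \<Longrightarrow>
      \<exists>\<mu>>0. \<forall>x\<in>M. \<exists>\<F>. finite \<F> \<and> \<F> \<subseteq> \<V> \<and> chain_ball M d x \<mu> \<subseteq> \<Union>\<F>"
  shows "uniformly_star_superparacompact M d"
  unfolding uniformly_star_superparacompact_def
proof (intro allI impI)
  fix \<V> assume \<V>: "open_cover mtopology \<V>"
  obtain \<mu> where \<mu>: "\<mu> > 0"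
    "\<forall>x\<in>M. \<exists>\<F>. finite \<F> \<and> \<F> \<subseteq> \<V> \<and> chain_ball M d x \<mu> \<subseteq> \<Union>\<F>"
    using H[OF \<V>] by blast
  define \<C> where "\<C> = (\<lambda>x. chain_ball M d x \<mu>) ` M"
  have "\<forall>C\<in>\<C>. \<exists>\<F>. finite \<F> \<and> \<F> \<subseteq> \<V> \<and> C \<subseteq> \<Union>\<F>"
    using \<mu>(2) by (auto simp: \<C>_def)
  then obtain G where G: "\<And>C. C \<in> \<C> \<Longrightarrow> finite (G C)" "\<And>C. C \<in> \<C> \<Longrightarrow> G C \<subseteq> \<V>"
      "\<And>C. C \<in> \<C> \<Longrightarrow> C \<subseteq> \<Union>(G C)"
    by metis
  define \<U> where "\<U> = (\<Union>C\<in>\<C>. (\<lambda>W. C \<inter> W) ` G C)"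
  have openV: "openin mtopology W" if "W \<in> \<V>" for W
    using \<V> that by (auto simp: open_cover_def)
  have "open_cover mtopology \<U>"
    unfolding open_cover_def
  proof (intro conjI ballI)
    fix U assume "U \<in> \<U>"
    then obtain C W where "U = C \<inter> W" "C \<in> \<C>" "W \<in> \<V>"
      using G(2) by (fastforce simp: \<U>_def)
    then show "openin mtopology U"
      using openV openin_chain_ball[OF \<mu>(1)] by (auto simp: \<C>_def)
  next
    have "\<Union>\<U> = \<Union>\<C>"
    proof (intro equalityI subsetI)
      fix x assume "x \<in> \<Union>\<C>"
      then obtain C where "C \<in> \<C>" "x \<in> C"
        by blast
      moreover from this obtain W where "W \<in> G C" "x \<in> W"
        using G(3) by blast
      ultimately show "x \<in> \<Union>\<U>"
        unfolding \<U>_def by blast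
    qed (auto simp: \<U>_def)
    moreover have "\<Union>\<C> = M"
      using chain_ball_subset chain_ball_refl by (fastforce simp: \<C>_def)
    ultimately show "\<Union>\<U> = topspace mtopology"
      by simp
  qed
  moreover have "cover_refines \<U> \<V>"
    using G(2) unfolding cover_refines_def \<U>_def by blast
  moreover have "meets_finitely_many (chain_ball M d x \<mu>) \<U>" if x: "x \<in> M" for x
  proof -
    define S where "S = chain_ball M d x \<mu>"
    have S: "S \<in> \<C>"
      using x by (simp add: S_def \<C>_def)
    have disj: "C = S" if "C \<in> \<C>" "C \<inter> S \<noteq> {}" for C
    proof -
      from that obtain y z where y: "C = chain_ball M d y \<mu>" and "z \<in> C" "z \<in> S"
        unfolding \<C>_def by blast
      then show ?thesis
        using chain_ball_eq[of z y \<mu>] chain_ball_eq[of z x \<mu>] by (simp add: S_def)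
    qed
    have "{U \<in> \<U>. S \<inter> U \<noteq> {}} \<subseteq> (\<lambda>W. S \<inter> W) ` G S"
    proof
      fix U assume "U \<in> {U \<in> \<U>. S \<inter> U \<noteq> {}}"
      then obtain C W where U: "C \<in> \<C>" "W \<in> G C" "U = C \<inter> W" "S \<inter> U \<noteq> {}"
        by (auto simp: \<U>_def)
      then have "C = S"
        by (intro disj) auto
      then show "U \<in> (\<lambda>W. S \<inter> W) ` G S"
        using U by blast
    qed
    then show ?thesis
      unfolding meets_finitely_many_def S_def[symmetric]
      using G(1)[OF S] by (meson finite_imageI finite_subset)
  qed
  ultimately show "\<exists>\<mu>>0. \<exists>\<U>. open_cover mtopology \<U> \<and> cover_refines \<U> \<V> \<and>
      (\<forall>x\<in>M. meets_finitely_many (chain_ball M d x \<mu>) \<U>)"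
    using \<mu>(1) by blast
qed

lemma superparacompact_imp_finitely_covered:
  assumes "uniformly_star_superparacompact M d" and "open_cover mtopology \<V>"
  shows "\<exists>\<mu>>0. \<forall>x\<in>M. \<exists>\<F>. finite \<F> \<and> \<F> \<subseteq> \<V> \<and> chain_ball M d x \<mu> \<subseteq> \<Union>\<F>"
proof -
  obtain \<mu> \<U> where \<mu>: "\<mu> > 0" and \<U>: "open_cover mtopology \<U>" "cover_refines \<U> \<V>"
      "\<And>x. x \<in> M \<Longrightarrow> finite {U \<in> \<U>. chain_ball M d x \<mu> \<inter> U \<noteq> {}}"
    using assms unfolding uniformly_star_superparacompact_def meets_finitely_many_def by blast
  obtain g where g: "\<And>U. U \<in> \<U> \<Longrightarrow> g U \<in> \<V> \<and> U \<subseteq> g U"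
    using \<U>(2) unfolding cover_refines_def by metis
  have "\<exists>\<F>. finite \<F> \<and> \<F> \<subseteq> \<V> \<and> chain_ball M d x \<mu> \<subseteq> \<Union>\<F>" if x: "x \<in> M" for x
  proof (intro exI conjI)
    let ?\<F> = "g ` {U \<in> \<U>. chain_ball M d x \<mu> \<inter> U \<noteq> {}}"
    show "finite ?\<F>"
      using \<U>(3)[OF x] by simp
    show "?\<F> \<subseteq> \<V>"
      using g by blast
    show "chain_ball M d x \<mu> \<subseteq> \<Union>?\<F>"
    proof
      fix y assume y: "y \<in> chain_ball M d x \<mu>"
      then have "y \<in> \<Union>\<U>"
        using \<U>(1) chain_ball_subset by (auto simp: open_cover_def)
      then obtain U where "U \<in> \<U>" "y \<in> U"
        by blast
      then show "y \<in> \<Union>?\<F>"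
        using g y by blast
    qed
  qed
  then show ?thesis
    using \<mu> by blast
qed

text \<open>The open sets that meet only finitely many members of a locally finite family form a
  cover.\<close>

lemma finitely_covered_imp_meets_finitely_many:
  assumes H: "\<And>\<V>. open_cover mtopology \<V> \<Longrightarrow>
      \<exists>\<mu>>0. \<forall>x\<in>M. \<exists>\<F>. finite \<F> \<and> \<F> \<subseteq> \<V> \<and> chain_ball M d x \<mu> \<subseteq> \<Union>\<F>"
    and lf: "locally_finite_in mtopology \<U>"
  shows "\<exists>\<mu>>0. \<forall>x\<in>M. meets_finitely_many (chain_ball M d x \<mu>) \<U>"
proof -
  define \<V> where "\<V> = {V. openin mtopology V \<and> finite {U \<in> \<U>. U \<inter> V \<noteq> {}}}"
  have "x \<in> \<Union>\<V>" if "x \<in> M" for x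
    using lf that unfolding locally_finite_in_def \<V>_def by auto
  then have "\<Union>\<V> = topspace mtopology"
    using openin_subset by (fastforce simp: \<V>_def)
  then have "open_cover mtopology \<V>"
    by (simp add: open_cover_def \<V>_def)
  from H[OF this] obtain \<mu> where \<mu>: "\<mu> > 0"
    "\<forall>x\<in>M. \<exists>\<F>. finite \<F> \<and> \<F> \<subseteq> \<V> \<and> chain_ball M d x \<mu> \<subseteq> \<Union>\<F>"
    by blast
  have "finite {U \<in> \<U>. chain_ball M d x \<mu> \<inter> U \<noteq> {}}" if x: "x \<in> M" for x
  proof -
    obtain \<F> where \<F>: "finite \<F>" "\<F> \<subseteq> \<V>" "chain_ball M d x \<mu> \<subseteq> \<Union>\<F>"
      using bspec[OF \<mu>(2) x] by blast
    then have "{U \<in> \<U>. chain_ball M d x \<mu> \<inter> U \<noteq> {}} \<subseteq> (\<Union>V\<in>\<F>. {U \<in> \<U>. U \<inter> V \<noteq> {}})"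
      by blast
    moreover have "finite (\<Union>V\<in>\<F>. {U \<in> \<U>. U \<inter> V \<noteq> {}})"
      using \<F>(1,2) by (intro finite_UN_I) (auto simp: \<V>_def)
    ultimately show ?thesis
      by (rule finite_subset)
  qed
  then show ?thesis
    using \<mu>(1) by (auto simp: meets_finitely_many_def)
qed

end

section \<open>The equivalences\<close>

text \<open>The implications proved above form a strongly connected graph on the twelve conditions: one
  cycle, followed in the first line of the assumptions, and four detours.\<close>

lemma all_equivalent_by_implication_graph:
  assumes "P4 \<Longrightarrow> P5" "P5 \<Longrightarrow> P6" "P6 \<Longrightarrow> P7" "P7 \<Longrightarrow> P2" "P2 \<Longrightarrow> P9" "P9 \<Longrightarrow> P8" "P8 \<Longrightarrow> P4"
    and "P4 \<Longrightarrow> P1" "P1 \<Longrightarrow> P4"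
    and "P4 \<Longrightarrow> P3" "P3 \<Longrightarrow> P7"
    and "P5 \<Longrightarrow> P10" "P10 \<Longrightarrow> P7"
    and "P9 \<Longrightarrow> P11" "P11 \<Longrightarrow> P12" "P12 \<Longrightarrow> P9"
  shows "all_equivalent [P1, P2, P3, P4, P5, P6, P7, P8, P9, P10, P11, P12]"
proof -
  have "P5 = P4" "P6 = P4" "P7 = P4" "P2 = P4" "P9 = P4" "P8 = P4"
    using assms(1-7) by blast+
  moreover from this have "P1 = P4" "P3 = P4" "P10 = P4" "P11 = P4" "P12 = P4"
    using assms(8-16) by blast+
  ultimately show ?thesis
    by (simp add: all_equivalent_def)
qed

(* In (6) the type variable 'b is arbitrary, so that the other conditions imply (6) for metric
   spaces of every type; for the converse the carrier type must be large enough (over a type with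
   one element the condition is vacuous), hence the conjunct for carriers in the reals. *)

theorem mainTheorem3:
  fixes M :: "'a set" and d :: "'a \<Rightarrow> 'a \<Rightarrow> real"
  assumes "Metric_space M d" and "\<exists>x\<in>M. \<exists>y\<in>M. x \<noteq> y"
  shows "all_equivalent
   [ \<comment> \<open>(1)\<close>
     uniformly_star_superparacompact M d,
     \<comment> \<open>(2)\<close>
     \<forall>\<sigma>. cofinally_Bourbaki_quasi_Cauchy M d \<sigma> \<longrightarrow> (\<exists>x. cluster_point (mtop M d) \<sigma> x),
     \<comment> \<open>(3)\<close>
     \<forall>\<U>. open_cover (mtop M d) \<U> \<and> locally_finite_in (mtop M d) \<U> \<longrightarrow>
       (\<exists>\<mu>>0. \<forall>x\<in>M. meets_finitely_many (chain_ball M d x \<mu>) \<U>),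
     \<comment> \<open>(4)\<close>
     \<forall>\<V>. open_cover (mtop M d) \<V> \<longrightarrow>
       (\<exists>\<mu>>0. \<forall>x\<in>M. \<exists>\<F>. finite \<F> \<and> \<F> \<subseteq> \<V> \<and> chain_ball M d x \<mu> \<subseteq> \<Union>\<F>),
     \<comment> \<open>(5)\<close>
     \<forall>\<V>. open_cover (mtop M d) \<V> \<and> directed_by_inclusion \<V> \<longrightarrow>
       (\<exists>\<mu>>0. cover_refines ((\<lambda>x. chain_ball M d x \<mu>) ` M) \<V>),
     \<comment> \<open>(6)\<close>
     continuous_maps_ulcb TYPE('b) M d \<and> continuous_maps_ulcb TYPE(real) M d,
     \<comment> \<open>(7)\<close>
     \<forall>f. continuous_map (mtop M d) euclideanreal f \<longrightarrow>
       unif_loc_component_bounded M d (UNIV :: real set) dist f M,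
     \<comment> \<open>(8)\<close>
     compactin (mtop M d) (nslc M d) \<and>
       (\<forall>\<delta>>0. \<exists>\<mu>>0. \<forall>x \<in> M - enlargement M d (nslc M d) \<delta>. f_c M d x > ereal \<mu>),
     \<comment> \<open>(9)\<close>
     \<forall>\<sigma>. range \<sigma> \<subseteq> M \<and> (\<lambda>n. f_c M d (\<sigma> n)) \<longlonglongrightarrow> 0 \<longrightarrow> (\<exists>x. cluster_point (mtop M d) \<sigma> x),
     \<comment> \<open>(10)\<close>
     \<forall>\<rho>. Metric_space M \<rho> \<and> mtop M \<rho> = mtop M d \<longrightarrow>
       (\<exists>\<delta>>0. \<forall>x\<in>M. Metric_space.mbounded M \<rho> (chain_ball M d x \<delta>)),
     \<comment> \<open>(11)\<close>
     \<forall>A. (\<forall>n. closedin (mtop M d) (A n) \<and> A n \<noteq> {}) \<and> decseq A \<and>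
         (\<lambda>n. INF x\<in>A n. f_c M d x) \<longlonglongrightarrow> 0 \<longrightarrow> (\<Inter>n. A n) \<noteq> {},
     \<comment> \<open>(12)\<close>
     \<forall>A. (\<forall>n. closedin (mtop M d) (A n) \<and> A n \<noteq> {}) \<and> decseq A \<and>
         (\<lambda>n. SUP x\<in>A n. f_c M d x) \<longlonglongrightarrow> 0 \<longrightarrow> (\<Inter>n. A n) \<noteq> {} ]"
    (is "all_equivalent [?P1, ?P2, ?P3, ?P4, ?P5, ?P6, ?P7, ?P8, ?P9, ?P10, ?P11, ?P12]")
proof -
  interpret Metric_space M d
    by (fact assms(1))
  show ?thesis
  proof (rule all_equivalent_by_implication_graph)
    show ?P5 if H: ?P4
    proof (intro allI impI; elim conjE)
      fix \<V> assume "open_cover mtopology \<V>" "directed_by_inclusion \<V>"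
      then show "\<exists>\<mu>>0. cover_refines ((\<lambda>x. chain_ball M d x \<mu>) ` M) \<V>"
        using finitely_covered_imp_directed_refinement H by metis
    qed
  next
    assume H: ?P5
    have ulcb_b: "unif_loc_component_bounded M d Y \<rho> f M"
      if "Metric_space Y \<rho>" "continuous_map mtopology (mtop Y \<rho>) f" for Y :: "'b set" and \<rho> f
      by (rule directed_refinement_imp_ulcb[OF _ that]) (use H in metis)
    have ulcb_real: "unif_loc_component_bounded M d Y \<rho> f M"
      if "Metric_space Y \<rho>" "continuous_map mtopology (mtop Y \<rho>) f" for Y :: "real set" and \<rho> f
      by (rule directed_refinement_imp_ulcb[OF _ that]) (use H in metis)
    show ?P6
      using ulcb_b ulcb_real unfolding continuous_maps_ulcb_def by metis
  next
    show ?P7 if H: ?P6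
    proof (intro allI impI)
      fix f assume "continuous_map mtopology euclideanreal f"
      then have "continuous_map mtopology (mtop UNIV dist) f"
        by simp
      moreover have "\<exists>u\<in>UNIV :: real set. \<exists>v\<in>UNIV. u \<noteq> v"
        by (intro bexI[of _ 0] bexI[of _ 1]) auto
      ultimately show "unif_loc_component_bounded M d (UNIV :: real set) dist f M"
        using conjunct2[OF H] Met_TC.Metric_space_axioms unfolding continuous_maps_ulcb_def by blast
    qed
  next
    show ?P2 if H: ?P7
    proof (intro allI impI)
      fix \<sigma> assume "cofinally_Bourbaki_quasi_Cauchy M d \<sigma>"
      then show "\<exists>x. cluster_point mtopology \<sigma> x"
        by (rule ulcb_imp_cofinally_BqC_cluster[rotated]) (use H in metis)
    qed
  next
    show ?P9 if H: ?P2
    proof (intro allI impI; elim conjE)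
      fix \<sigma> assume "range \<sigma> \<subseteq> M" "(\<lambda>n. f_c M d (\<sigma> n)) \<longlonglongrightarrow> 0"
      then show "\<exists>x. cluster_point mtopology \<sigma> x"
        by (rule f_c_null_cluster_point[rotated]) (use H in metis)
    qed
  next
    show ?P8 if H: ?P9
    proof -
      note null = H[rule_format, OF conjI]
      show ?thesis
        using nslc_compact_and_uniform[OF null] by simp
    qed
  next
    show ?P4 if H: ?P8
    proof (intro allI impI)
      fix \<V> assume \<V>: "open_cover mtopology \<V>"
      show "\<exists>\<mu>>0. \<forall>x\<in>M. \<exists>\<F>. finite \<F> \<and> \<F> \<subseteq> \<V> \<and> chain_ball M d x \<mu> \<subseteq> \<Union>\<F>"
        by (rule chain_balls_finitely_covered[OF conjunct1[OF H] _ \<V>]) (rule conjunct2[OF H, rule_format])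
    qed
  next
    show ?P1 if H: ?P4
      by (rule finitely_covered_imp_superparacompact) (rule H[rule_format])
  next
    show ?P4 if H: ?P1
      using superparacompact_imp_finitely_covered[OF H] by metis
  next
    show ?P3 if H: ?P4
    proof (intro allI impI; elim conjE)
      fix \<U> assume "locally_finite_in mtopology \<U>"
      then show "\<exists>\<mu>>0. \<forall>x\<in>M. meets_finitely_many (chain_ball M d x \<mu>) \<U>"
        by (rule finitely_covered_imp_meets_finitely_many[rotated]) (rule H[rule_format])
    qed
  next
    show ?P7 if H: ?P3
    proof (intro allI impI)
      fix f assume "continuous_map mtopology euclideanreal f"
      then show "unif_loc_component_bounded M d (UNIV :: real set) dist f M"
        by (rule locally_finite_imp_ulcb[rotated]) (rule H[rule_format, OF conjI])
    qed
  next
    show ?P10 if H: ?P5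
    proof (intro allI impI; elim conjE)
      fix \<rho> assume \<rho>: "Metric_space M \<rho>" "mtop M \<rho> = mtopology"
      have "unif_loc_component_bounded M d M \<rho> (\<lambda>x. x) M"
        by (rule directed_refinement_imp_ulcb) (use H[rule_format, OF conjI] \<rho> in simp_all)
      then show "\<exists>\<delta>>0. \<forall>x\<in>M. Metric_space.mbounded M \<rho> (chain_ball M d x \<delta>)"
        by (simp add: unif_loc_component_bounded_def)
    qed
  next
    show ?P7 if H: ?P10
    proof (intro allI impI)
      fix f assume "continuous_map mtopology euclideanreal f"
      then show "unif_loc_component_bounded M d (UNIV :: real set) dist f M"
        by (rule equivalent_metrics_bounded_imp_ulcb[rotated]) (rule H[rule_format, OF conjI])
    qed
  next
    show ?P11 if H: ?P9
    proof (intro allI impI; elim conjE)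
      fix A assume A: "\<forall>n. closedin mtopology (A n) \<and> A n \<noteq> {}" "decseq A"
        "(\<lambda>n. INF x\<in>A n. f_c M d x) \<longlonglongrightarrow> 0"
      show "(\<Inter>n. A n) \<noteq> {}"
        by (rule Inter_nonempty_if_f_c_null_cluster[OF H[rule_format, OF conjI]]) (use A in auto)
    qed
  next
    show ?P12 if H: ?P11
    proof (intro allI impI; elim conjE)
      fix A assume A: "\<forall>n. closedin mtopology (A n) \<and> A n \<noteq> {}" "decseq A"
        and lim: "(\<lambda>n. SUP x\<in>A n. f_c M d x) \<longlonglongrightarrow> 0"
      have "(\<lambda>n. INF x\<in>A n. f_c M d x) \<longlonglongrightarrow> 0"
      proof (rule tendsto_sandwich[OF _ _ tendsto_const lim])
        show "\<forall>\<^sub>F n in sequentially. 0 \<le> (INF x\<in>A n. f_c M d x)"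
          by (intro always_eventually allI INF_greatest f_c_nonneg)
        show "\<forall>\<^sub>F n in sequentially. (INF x\<in>A n. f_c M d x) \<le> (SUP x\<in>A n. f_c M d x)"
          using A(1) by (intro always_eventually allI INF_le_SUP) auto
      qed
      then show "(\<Inter>n. A n) \<noteq> {}"
        using A H by metis
    qed
  next
    show ?P9 if H: ?P12
    proof (intro allI impI; elim conjE)
      fix \<sigma> assume "range \<sigma> \<subseteq> M" "(\<lambda>n. f_c M d (\<sigma> n)) \<longlonglongrightarrow> 0"
      then show "\<exists>x. cluster_point mtopology \<sigma> x"
        by (rule f_c_null_cluster_if_Inter_nonempty[rotated]) (use H in metis)
    qed
  qed
qed

end
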